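(* Let $V$ be a finite dimensional real inner product space, let $K$ be a self-dual cone in $V$, and let $e\in K^\circ$. Suppose $L$ is a $Z$-transformation on $K$ with $v(L,e)=0$. Then the game $(L,e)$ is completely mixed if and only if $L$ is space-irreducible (relative to $K$).
   Context: $V$ is a finite dimensional real inner product space with inner product $\langle\cdot,\cdot\rangle$. A cone $K\subseteq V$ is proper if it is a pointed closed convex cone with nonempty interior $K^\circ$. Its dual is $K^*=\{x\in V:\langle x,y\rangle\ge 0\ \forall y\in K\}$; $K$ is self-dual if $K=K^*$ (a self-dual cone is proper). Linear game: for $e\in K^\circ$ let $\Delta(e)=\{x\in K:\langle x,e\rangle=1\}$ (the strategies). For a linear transformation $L:V\to V$, a pair $(\overline{x},\overline{y})\in\Delta(e)\times\Delta(e)$ is an optimal strategy pair of the game $(L,e)$ if $\langle L(x),\overline{y}\rangle\le\langle L(\overline{x}),\overline{y}\rangle\le\langle L(\overline{x}),y\rangle$ for all $x,y\in\Delta(e)$. Such pairs exist, and the value of the game is $v(L,e)=\langle L(\overline{x}),\overline{y}\rangle=\max_{x\in\Delta(e)}\min_{y\in\Delta(e)}\langle L(x),y\rangle=\min_{y\in\Delta(e)}\max_{x\in\Delta(e)}\langle L(x),y\rangle$. The game $(L,e)$ is completely mixed if for every optimal strategy pair $(\overline{x},\overline{y})$ both $\overline{x}$ and $\overline{y}$ belong to $K^\circ$. A linear transformation $L$ on $V$ is a $Z$-transformation on $K$ if $x\in K$, $y\in K^*$, $\langle x,y\rangle=0$ imply $\langle L(x),y\rangle\le 0$. A face of $K$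 is a convex cone $F\subseteq K$ such that if $a\in F$ and $a=b+c$ with $b,c\in K$, then $b,c\in F$. $L$ is space-irreducible (relative to $K$) if whenever $F$ is a face of $K$ with $L(F-F)\subseteq F-F$, then $F=\{0\}$ or $F=K$. *)

theory Defs
  imports "HOL-Analysis.Analysis"
begin

definition dual_cone :: "'a::real_inner set \<Rightarrow> 'a set" where
  "dual_cone K = {x. \<forall>y\<in>K. x \<bullet> y \<ge> 0}"

definition self_dual_cone :: "'a::real_inner set \<Rightarrow> bool" where
  "self_dual_cone K \<longleftrightarrow> convex_cone K \<and> K = dual_cone K"

definition strategies :: "'a::real_inner set \<Rightarrow> 'a \<Rightarrow> 'a set" where
  "strategies K e = {x \<in> K. x \<bullet> e = 1}"

definition optimal_pair :: "'a::real_inner set \<Rightarrow> ('a \<Rightarrow> 'a) \<Rightarrow> 'a \<Rightarrow> 'a \<Rightarrow> 'a \<Rightarrow> bool" where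
  "optimal_pair K L e xb yb \<longleftrightarrow>
     xb \<in> strategies K e \<and> yb \<in> strategies K e \<and>
     (\<forall>x\<in>strategies K e. \<forall>y\<in>strategies K e.
        L x \<bullet> yb \<le> L xb \<bullet> yb \<and> L xb \<bullet> yb \<le> L xb \<bullet> y)"

lemma optimal_pair_payoff_unique:
  assumes "optimal_pair K L e x y" "optimal_pair K L e x' y'"
  shows "L x \<bullet> y = L x' \<bullet> y'"
  using assms unfolding optimal_pair_def by (meson antisym order_trans)

text \<open>The common payoff of all optimal strategy pairs. By the preceding lemma the description
  determines at most one number; it determines one as soon as an optimal pair exists, which the
  minimax theorem guarantees when \<open>K\<close> is a proper self-dual cone in a space of positive dimension,
  \<open>e\<close> is an interior point of \<open>K\<close> and \<open>L\<close> is linear.\<close>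

definition game_value :: "'a::real_inner set \<Rightarrow> ('a \<Rightarrow> 'a) \<Rightarrow> 'a \<Rightarrow> real" where
  "game_value K L e = (THE v. \<exists>xb yb. optimal_pair K L e xb yb \<and> v = L xb \<bullet> yb)"

definition completely_mixed :: "'a::real_inner set \<Rightarrow> ('a \<Rightarrow> 'a) \<Rightarrow> 'a \<Rightarrow> bool" where
  "completely_mixed K L e \<longleftrightarrow>
     (\<forall>xb yb. optimal_pair K L e xb yb \<longrightarrow> xb \<in> interior K \<and> yb \<in> interior K)"

definition Z_transformation :: "'a::real_inner set \<Rightarrow> ('a \<Rightarrow> 'a) \<Rightarrow> bool" where
  "Z_transformation K L \<longleftrightarrow>
     linear L \<and> (\<forall>x\<in>K. \<forall>y\<in>dual_cone K. x \<bullet> y = 0 \<longrightarrow> L x \<bullet> y \<le> 0)"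

text \<open>Unlike \<^const>\<open>face_of\<close>, this requires \<open>F\<close> to be a convex cone, which by
  \<^const>\<open>convex_cone\<close> is nonempty and so contains \<open>0\<close>.\<close>

definition cone_face :: "'a::real_vector set \<Rightarrow> 'a set \<Rightarrow> bool" where
  "cone_face F K \<longleftrightarrow>
     convex_cone F \<and> F \<subseteq> K \<and>
     (\<forall>a\<in>F. \<forall>b\<in>K. \<forall>c\<in>K. a = b + c \<longrightarrow> b \<in> F \<and> c \<in> F)"

text \<open>The algebraic difference \<open>F - F\<close>; the operator \<open>-\<close> on sets denotes relative complement.\<close>

definition cone_diff :: "'a::real_vector set \<Rightarrow> 'a set" where
  "cone_diff F = {a - b | a b. a \<in> F \<and> b \<in> F}"

definition space_irreducible :: "'a::real_vector set \<Rightarrow> ('a \<Rightarrow> 'a) \<Rightarrow> bool" where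
  "space_irreducible K L \<longleftrightarrow>
     (\<forall>F. cone_face F K \<and> L ` cone_diff F \<subseteq> cone_diff F \<longrightarrow> F = {0} \<or> F = K)"

end

theory Submission
  imports Defs
begin

text \<open>The link between the game and the faces of \<open>K\<close> is the resolvent
  \<open>T = (L + s I)\<^sup>-\<^sup>1\<close>. For large \<open>s\<close> the map \<open>L + s I\<close> is again a Z-transformation and sends \<open>e\<close> into
  the interior of \<open>K\<close>; such a map is inverse positive (\<open>Z_inverse_positive\<close>), so \<open>T\<close> exists and maps \<open>K\<close>
  into \<open>K\<close> (\<open>Z_resolvent\<close>). A subspace is invariant under \<open>L\<close> iff it is invariant under \<open>T\<close>, and a
  face satisfies \<open>F = K \<inter> (F - F)\<close>. Hence the span of a face is \<open>L\<close>-invariant iff \<open>T\<close> maps the face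
  into itself, and invariance becomes a statement about a positive map on a cone.

  When the value is \<open>0\<close>, a pair of strategies \<open>x, y\<close> is optimal iff \<open>L x \<in> K\<close> and \<open>L z \<bullet> y \<le> 0\<close> for all
  \<open>z \<in> K\<close>. If in addition \<open>x\<close> is interior, then the functional \<open>z \<mapsto> L z \<bullet> y\<close> is nonpositive on \<open>K\<close> and
  vanishes at an interior point, so it vanishes identically.

  Suppose the game is completely mixed and \<open>F \<noteq> {0}\<close> is a face with invariant span. Brouwer's theorem,
  applied to the normalization of \<open>T\<close> on the strategies in \<open>F\<close>, gives an eigenvector \<open>x \<in> F\<close> of \<open>L\<close>.
  An optimal pair \<open>(x', y)\<close> exists by the minimax theorem (\<open>optimal_pair_exists\<close>). Both of its strategies
  are interior, so \<open>L z \<bullet> y = 0\<close> for all \<open>z\<close> and \<open>x \<bullet> y > 0\<close>; thus the eigenvalue is \<open>0\<close>. Then \<open>(x, y)\<close>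
  is optimal as well, so \<open>x\<close> is interior, and a face that contains an interior point is \<open>K\<close>.

  Suppose conversely that \<open>L\<close> is space-irreducible and \<open>(x, y)\<close> is optimal. From \<open>L x \<in> K\<close> it follows that
  \<open>T x \<le> x / s\<close> in the order of \<open>K\<close>, so \<open>T\<close> preserves the face generated by \<open>x\<close>. That face is
  therefore \<open>K\<close>, and \<open>x\<close> is interior. Now \<open>L z \<bullet> y = 0\<close> for all \<open>z\<close>, so \<open>T\<close> preserves the face of \<open>K\<close>
  orthogonal to \<open>y\<close>. It does not contain \<open>y\<close>, so it is \<open>{0}\<close>, and \<open>y\<close> is interior.\<close>

section \<open>Self-dual cones with a distinguished interior point\<close>

locale self_dual_cone_unit =
  fixes K :: "'a::euclidean_space set" and e :: 'a
  assumes self_dual: "self_dual_cone K"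
    and unit_interior: "e \<in> interior K"
begin

lemma cone: "convex_cone K"
  using self_dual by (simp add: self_dual_cone_def)

lemma mem_iff: "x \<in> K \<longleftrightarrow> (\<forall>y\<in>K. x \<bullet> y \<ge> 0)"
  using self_dual by (auto simp: self_dual_cone_def dual_cone_def)

lemma dual_eq: "dual_cone K = K"
  using self_dual by (simp add: self_dual_cone_def)

lemma add_mem: "x \<in> K \<Longrightarrow> y \<in> K \<Longrightarrow> x + y \<in> K"
  by (rule convex_cone_add[OF cone])

lemma scale_mem: "x \<in> K \<Longrightarrow> c \<ge> 0 \<Longrightarrow> c *\<^sub>R x \<in> K"
  using convex_cone_scaleR[OF cone] by blast

lemma inner_nonneg: "x \<in> K \<Longrightarrow> y \<in> K \<Longrightarrow> x \<bullet> y \<ge> 0"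
  using mem_iff by blast

lemma unit_mem: "e \<in> K"
  using unit_interior interior_subset by blast

lemma closed_cone: "closed K"
proof -
  have "K = (\<Inter>y\<in>K. {x. y \<bullet> x \<ge> 0})"
  proof (rule set_eqI)
    fix x
    show "x \<in> K \<longleftrightarrow> x \<in> (\<Inter>y\<in>K. {x. y \<bullet> x \<ge> 0})"
      by (subst mem_iff) (auto simp: inner_commute)
  qed
  moreover have "closed (\<Inter>y\<in>K. {x. y \<bullet> x \<ge> 0})"
    by (intro closed_INT ballI closed_halfspace_ge)
  ultimately show ?thesis by simp
qed

lemma pointed:
  assumes "x \<in> K" "- x \<in> K"
  shows "x = 0"
  using inner_nonneg[OF assms] by (metis inner_ge_zero inner_eq_zero_iff inner_minus_right neg_0_le_iff_le order_antisym)

lemma interior_absorbs: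
  assumes "d \<in> interior K"
  obtains \<epsilon> where "\<epsilon> > 0" "d + \<epsilon> *\<^sub>R x \<in> K" "d - \<epsilon> *\<^sub>R x \<in> K"
proof -
  obtain r where r: "r > 0" "cball d r \<subseteq> K"
    using assms by (meson mem_interior_cball)
  define \<epsilon> where "\<epsilon> = r / (norm x + 1)"
  have eps: "\<epsilon> > 0" using r by (simp add: \<epsilon>_def add_nonneg_pos)
  have "\<epsilon> * norm x \<le> r"
    using r by (simp add: \<epsilon>_def pos_divide_le_eq add_nonneg_pos)
  then have "d + \<epsilon> *\<^sub>R x \<in> cball d r" "d - \<epsilon> *\<^sub>R x \<in> cball d r"
    using eps by (simp_all add: dist_norm)
  then show thesis using that eps r by blast
qed

lemma interior_inner_pos:
  assumes "d \<in> interior K" "y \<in> K" "y \<noteq> 0"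
  shows "d \<bullet> y > 0"
proof -
  obtain \<epsilon> where "\<epsilon> > 0" "d - \<epsilon> *\<^sub>R y \<in> K"
    using interior_absorbs[OF assms(1)] by blast
  then have "d \<bullet> y \<ge> \<epsilon> * (y \<bullet> y)" "\<epsilon> * (y \<bullet> y) > 0"
    using inner_nonneg[of "d - \<epsilon> *\<^sub>R y" y] assms by (auto simp: inner_diff_left)
  then show ?thesis by linarith
qed

text \<open>A point that dominates a positive multiple of \<open>e\<close> inherits a scaled copy of a ball around \<open>e\<close>. This
  lets interior points be handled by cone inequalities alone.\<close>

lemma interior_iff: "x \<in> interior K \<longleftrightarrow> (\<exists>m>0. x - m *\<^sub>R e \<in> K)"
proof
  assume "x \<in> interior K"
  then show "\<exists>m>0. x - m *\<^sub>R e \<in> K" using interior_absorbs by metis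
next
  assume "\<exists>m>0. x - m *\<^sub>R e \<in> K"
  then obtain m where m: "m > 0" "x - m *\<^sub>R e \<in> K" by blast
  obtain r where r: "r > 0" "ball e r \<subseteq> K"
    using unit_interior by (meson mem_interior)
  have "ball x (m * r) \<subseteq> K"
  proof
    fix z assume z: "z \<in> ball x (m * r)"
    define u where "u = (1 / m) *\<^sub>R (z - x)"
    have "norm u < r"
      using z m by (simp add: u_def dist_norm norm_minus_commute pos_divide_less_eq mult.commute)
    then have "e + u \<in> K" using r by (auto simp: dist_norm)
    then have "m *\<^sub>R (e + u) + (x - m *\<^sub>R e) \<in> K" using m add_mem scale_mem by simp
    moreover have "m *\<^sub>R (e + u) + (x - m *\<^sub>R e) = z"
      using m by (simp add: u_def algebra_simps)
    ultimately show "z \<in> K" by simp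
  qed
  moreover have "m * r > 0" using m r by simp
  ultimately show "x \<in> interior K" by (meson mem_interior)
qed

lemma strategies_subset: "strategies K e \<subseteq> K"
  by (auto simp: strategies_def)

lemma strategiesD: "x \<in> strategies K e \<Longrightarrow> x \<bullet> e = 1" "x \<in> strategies K e \<Longrightarrow> e \<bullet> x = 1"
  by (auto simp: strategies_def inner_commute)

lemma strategies_nonzero: "x \<in> strategies K e \<Longrightarrow> x \<noteq> 0"
  by (auto simp: strategies_def)

lemma normalize_strategy:
  assumes "x \<in> K" "x \<noteq> 0"
  shows "x \<bullet> e > 0" "(1 / (x \<bullet> e)) *\<^sub>R x \<in> strategies K e"
proof -
  show pos: "x \<bullet> e > 0"
    using interior_inner_pos[OF unit_interior assms] by (simp add: inner_commute)
  then show "(1 / (x \<bullet> e)) *\<^sub>R x \<in> strategies K e"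
    using assms scale_mem by (simp add: strategies_def)
qed

lemma strategies_nonempty: "strategies K e \<noteq> {}"
proof -
  have "e \<noteq> 0"
  proof
    assume "e = 0"
    then obtain r where r: "r > 0" "cball 0 r \<subseteq> K"
      using unit_interior by (meson mem_interior_cball)
    obtain b :: 'a where b: "b \<in> Basis" using nonempty_Basis by blast
    have "r *\<^sub>R b \<in> cball 0 r" "- (r *\<^sub>R b) \<in> cball 0 r" using b r by auto
    then show False using pointed[of "r *\<^sub>R b"] r nonzero_Basis[OF b] by (auto simp: subset_iff)
  qed
  then show ?thesis using normalize_strategy(2)[OF unit_mem] by blast
qed

lemma strategies_convex: "convex (strategies K e)"
proof -
  have "strategies K e = K \<inter> {x. e \<bullet> x = 1}"
    by (auto simp: strategies_def inner_commute)
  then show ?thesis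
    using cone by (simp add: convex_cone_def convex_Int convex_hyperplane)
qed

lemma strategies_compact: "compact (strategies K e)"
proof -
  have eq: "strategies K e = K \<inter> {x. e \<bullet> x = 1}"
    by (auto simp: strategies_def inner_commute)
  then have "closed (strategies K e)"
    using closed_cone by (simp add: closed_Int closed_hyperplane)
  moreover have "bounded (strategies K e)"
  proof -
    obtain r where r: "r > 0" "cball e r \<subseteq> K"
      using unit_interior by (meson mem_interior_cball)
    \<comment> \<open>Moving from \<open>e\<close> by \<open>r\<close> against the direction of \<open>x\<close> stays in \<open>K\<close>, so the result pairs
      nonnegatively with \<open>x\<close>.\<close>
    have "norm x \<le> 1 / r" if x: "x \<in> strategies K e" for x
    proof -
      have nz: "x \<noteq> 0" using x strategies_nonzero by blast
      have "e - (r / norm x) *\<^sub>R x \<in> cball e r"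
        using nz r by (simp add: dist_norm)
      then have "(e - (r / norm x) *\<^sub>R x) \<bullet> x \<ge> 0"
        using x r strategies_subset inner_nonneg by blast
      then have "r * norm x \<le> 1"
        using nz strategiesD[OF x]
        by (simp add: inner_diff_left dot_square_norm power2_eq_square)
      then show ?thesis using r by (simp add: field_simps)
    qed
    then show ?thesis unfolding bounded_iff by blast
  qed
  ultimately show ?thesis by (simp add: compact_eq_bounded_closed)
qed

lemma mem_if_nonneg_on_strategies:
  assumes "\<And>y. y \<in> strategies K e \<Longrightarrow> x \<bullet> y \<ge> 0"
  shows "x \<in> K"
proof -
  have "x \<bullet> y \<ge> 0" if "y \<in> K" for y
  proof (cases "y = 0")
    case False
    have "x \<bullet> ((1 / (y \<bullet> e)) *\<^sub>R y) \<ge> 0"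
      by (intro assms normalize_strategy(2)[OF that False])
    then show ?thesis using normalize_strategy(1)[OF that False] by (simp add: zero_le_divide_iff)
  qed simp
  then show ?thesis by (subst mem_iff) blast
qed

text \<open>Subtracting from \<open>x\<close> its least payoff, as a multiple of \<open>e\<close>, lands exactly on the boundary of \<open>K\<close>,
  and the minimizing strategy \<open>y\<close> is a supporting functional there. This supplies the orthogonal pairs
  to which the Z-property applies.\<close>

lemma minimizing_strategy:
  obtains y where "y \<in> strategies K e" "x - (x \<bullet> y) *\<^sub>R e \<in> K"
    "(x - (x \<bullet> y) *\<^sub>R e) \<bullet> y = 0"
proof -
  have "continuous_on (strategies K e) (\<lambda>y. x \<bullet> y)"
    by (intro continuous_intros)
  then obtain y where y: "y \<in> strategies K e" "\<forall>z\<in>strategies K e. x \<bullet> y \<le> x \<bullet> z"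
    using continuous_attains_inf[OF strategies_compact strategies_nonempty] by blast
  have "x - (x \<bullet> y) *\<^sub>R e \<in> K"
    by (rule mem_if_nonneg_on_strategies)
      (use y in \<open>auto simp: strategiesD inner_diff_left\<close>)
  moreover have "(x - (x \<bullet> y) *\<^sub>R e) \<bullet> y = 0"
    using y by (simp add: strategiesD inner_diff_left)
  ultimately show thesis using that y by blast
qed

lemma interior_if_inner_pos:
  assumes "\<And>y. y \<in> strategies K e \<Longrightarrow> x \<bullet> y > 0"
  shows "x \<in> interior K"
proof -
  obtain y where "y \<in> strategies K e" "x - (x \<bullet> y) *\<^sub>R e \<in> K"
    using minimizing_strategy by blast
  then show ?thesis using assms by (subst interior_iff) blast
qed


section \<open>The value of a linear game\<close>

text \<open>\<open>L x - v e \<in> K\<close> says that \<open>x\<close> guarantees the payoff \<open>v\<close>. The pairs \<open>(x, v)\<close> with this property form a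
  closed set on which \<open>v\<close> is bounded above, so a best guaranteed payoff is attained.\<close>

lemma maximal_guarantee:
  assumes "linear L"
  obtains x v where "x \<in> strategies K e" "L x - v *\<^sub>R e \<in> K"
    "\<And>x' v'. x' \<in> strategies K e \<Longrightarrow> L x' - v' *\<^sub>R e \<in> K \<Longrightarrow> v' \<le> v"
proof -
  let ?D = "strategies K e"
  have cont: "continuous_on A L" for A
    using assms by (simp add: linear_continuous_on linear_conv_bounded_linear)
  have "compact ((\<lambda>x. L x \<bullet> e) ` ?D)"
    by (intro compact_continuous_image continuous_intros cont strategies_compact)
  then have "bdd_above ((\<lambda>x. L x \<bullet> e) ` ?D)"
    by (intro bounded_imp_bdd_above compact_imp_bounded)
  then obtain B where B: "\<And>x. x \<in> ?D \<Longrightarrow> L x \<bullet> e \<le> B"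
    unfolding bdd_above_def by blast
  have ee: "e \<bullet> e > 0"
    using strategies_nonempty by (auto simp: strategies_def)
  have upper: "v \<le> B / (e \<bullet> e)" if "x \<in> ?D" "L x - v *\<^sub>R e \<in> K" for x v
  proof -
    have "(L x - v *\<^sub>R e) \<bullet> e \<ge> 0" using that inner_nonneg unit_mem by blast
    then have "v * (e \<bullet> e) \<le> B" using B[OF that(1)] by (simp add: inner_diff_left)
    then show ?thesis using ee by (simp add: field_simps)
  qed
  obtain x0 where x0: "x0 \<in> ?D" using strategies_nonempty by blast
  obtain y0 where y0: "L x0 - (L x0 \<bullet> y0) *\<^sub>R e \<in> K"
    using minimizing_strategy by blast
  define v0 where "v0 = L x0 \<bullet> y0"
  \<comment> \<open>Cutting off below at a payoff that some strategy does guarantee keeps the set nonempty and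
    makes it compact.\<close>
  define S where "S = (?D \<times> {v0..B / (e \<bullet> e)}) \<inter> (\<lambda>p. L (fst p) - snd p *\<^sub>R e) -` K"
  have "compact S"
    unfolding S_def
  proof (intro compact_Int_closed compact_Times strategies_compact compact_Icc)
    have "continuous_on UNIV (\<lambda>p. L (fst p) - snd p *\<^sub>R e)"
      by (intro continuous_intros continuous_on_compose2[OF cont]) auto
    then show "closed ((\<lambda>p. L (fst p) - snd p *\<^sub>R e) -` K)"
      using closed_cone closed_vimage by blast
  qed
  moreover have "(x0, v0) \<in> S"
    using x0 y0 upper[of x0 v0] by (simp add: S_def v0_def)
  ultimately obtain p where p: "p \<in> S" "\<forall>q\<in>S. snd q \<le> snd p"
    using continuous_attains_sup[of S snd] continuous_on_snd[OF continuous_on_id] by blast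
  show thesis
  proof
    show "fst p \<in> ?D" "L (fst p) - snd p *\<^sub>R e \<in> K"
      using p by (auto simp: S_def)
    fix x' v' assume *: "x' \<in> ?D" "L x' - v' *\<^sub>R e \<in> K"
    show "v' \<le> snd p"
    proof (cases "v' < v0")
      case True
      then show ?thesis using p(2) \<open>(x0, v0) \<in> S\<close> by force
    next
      case False
      then have "(x', v') \<in> S" using * upper by (auto simp: S_def)
      then show ?thesis using p(2) by force
    qed
  qed
qed

text \<open>The minimax theorem. Let \<open>v\<close> be the best payoff that the maximizer can guarantee. No \<open>L x - v e\<close> is
  interior to \<open>K\<close>, since otherwise slightly more than \<open>v\<close> could be guaranteed. A hyperplane that separates
  these vectors from the interior of \<open>K\<close> has its normal in \<open>K\<close> by self-duality, and the normalized normal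
  is a strategy that holds the maximizer down to \<open>v\<close>.\<close>

theorem optimal_pair_exists:
  assumes "linear L"
  shows "\<exists>x y. optimal_pair K L e x y"
proof -
  let ?D = "strategies K e"
  obtain x v where x: "x \<in> ?D" "L x - v *\<^sub>R e \<in> K"
    and max: "\<And>x' v'. x' \<in> ?D \<Longrightarrow> L x' - v' *\<^sub>R e \<in> K \<Longrightarrow> v' \<le> v"
    using maximal_guarantee[OF assms] by blast
  let ?C = "(\<lambda>x. L x - v *\<^sub>R e) ` ?D"
  have "?C = (\<lambda>z. z - v *\<^sub>R e) ` (L ` ?D)" by auto
  then have "convex ?C"
    using convex_linear_image[OF assms strategies_convex]
    by (metis convex_translation_subtract)
  moreover have "?C \<inter> interior K = {}"
  proof -
    have False if x': "x' \<in> ?D" "L x' - v *\<^sub>R e \<in> interior K" for x'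
    proof -
      obtain m where "m > 0" "L x' - v *\<^sub>R e - m *\<^sub>R e \<in> K"
        using x'(2)[unfolded interior_iff] by blast
      moreover have "L x' - v *\<^sub>R e - m *\<^sub>R e = L x' - (v + m) *\<^sub>R e"
        by (simp add: algebra_simps)
      ultimately show False using max[OF x'(1), of "v + m"] by simp
    qed
    then show ?thesis by blast
  qed
  moreover have "convex (interior K)"
    using cone by (simp add: convex_cone_def convex_interior)
  moreover have "interior K \<noteq> {}" using unit_interior by blast
  moreover have "?C \<noteq> {}" using strategies_nonempty by blast
  ultimately obtain a b where a: "a \<noteq> 0" "\<And>z. z \<in> ?C \<Longrightarrow> a \<bullet> z \<le> b"
      "\<And>z. z \<in> interior K \<Longrightarrow> a \<bullet> z \<ge> b"
    using separating_hyperplane_sets[of ?C "interior K"] by blast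
  have a_shift: "a \<bullet> k + m * (a \<bullet> e) \<ge> b" if "k \<in> K" "m > 0" for k m
  proof -
    have "k + m *\<^sub>R e \<in> interior K"
      using that by (subst interior_iff) (auto intro!: exI[of _ m])
    then show ?thesis using a(3) by (fastforce simp: inner_add_right)
  qed
  have "a \<bullet> k \<ge> 0" if k: "k \<in> K" for k
  proof (rule ccontr)
    assume neg: "\<not> a \<bullet> k \<ge> 0"
    \<comment> \<open>Far enough along the ray through \<open>k\<close>, the lower bound \<open>b\<close> would be violated.\<close>
    define t where "t = (\<bar>b\<bar> + \<bar>a \<bullet> e\<bar> + 1) / (- (a \<bullet> k))"
    have "t \<ge> 0" unfolding t_def using neg by (intro divide_nonneg_nonneg) auto
    then have "a \<bullet> (t *\<^sub>R k) + 1 * (a \<bullet> e) \<ge> b"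
      using a_shift[of "t *\<^sub>R k" 1] scale_mem[OF k] by simp
    moreover have "a \<bullet> (t *\<^sub>R k) = - (\<bar>b\<bar> + \<bar>a \<bullet> e\<bar> + 1)"
      using neg by (simp add: t_def field_simps)
    ultimately show False by linarith
  qed
  then have aK: "a \<in> K" by (subst mem_iff) blast
  have ae: "a \<bullet> e > 0" using normalize_strategy(1)[OF aK a(1)] .
  have b: "b \<le> 0"
  proof (rule ccontr)
    assume "\<not> b \<le> 0"
    then show False
      using a_shift[of 0 "b / (2 * (a \<bullet> e))"] ae cone
      by (simp add: convex_cone_contains_0)
  qed
  define y where "y = (1 / (a \<bullet> e)) *\<^sub>R a"
  have y: "y \<in> ?D" unfolding y_def using normalize_strategy(2)[OF aK a(1)] .
  have up: "L x' \<bullet> y \<le> v" if "x' \<in> ?D" for x'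
  proof -
    have "a \<bullet> (L x' - v *\<^sub>R e) \<le> 0" using a(2) that b by fastforce
    then have "a \<bullet> L x' \<le> v * (a \<bullet> e)" by (simp add: inner_diff_right)
    then show ?thesis using ae by (simp add: y_def field_simps inner_commute)
  qed
  have low: "v \<le> L x \<bullet> y'" if "y' \<in> ?D" for y'
    using inner_nonneg[OF x(2), of y'] that strategiesD[OF that] strategies_subset
    by (auto simp: inner_diff_left)
  have "L x \<bullet> y = v" using up[OF x(1)] low[OF y] by simp
  then have "optimal_pair K L e x y"
    using x y up low by (auto simp: optimal_pair_def)
  then show ?thesis by blast
qed

lemma game_value_eq:
  assumes "optimal_pair K L e x y"
  shows "game_value K L e = L x \<bullet> y"
  unfolding game_value_def
  using assms optimal_pair_payoff_unique by (intro the_equality) blast+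

lemma optimal_pair_zero_iff:
  assumes "linear L" "game_value K L e = 0"
  shows "optimal_pair K L e x y \<longleftrightarrow>
    x \<in> strategies K e \<and> y \<in> strategies K e \<and> L x \<in> K \<and> (\<forall>z\<in>K. L z \<bullet> y \<le> 0)"
proof
  assume opt: "optimal_pair K L e x y"
  then have zero: "L x \<bullet> y = 0" using game_value_eq assms by metis
  have "L x \<in> K"
    using opt zero by (intro mem_if_nonneg_on_strategies) (auto simp: optimal_pair_def)
  moreover have "L z \<bullet> y \<le> 0" if z: "z \<in> K" for z
  proof (cases "z = 0")
    case True
    then show ?thesis using assms(1) by (simp add: linear_0)
  next
    case False
    then have "L ((1 / (z \<bullet> e)) *\<^sub>R z) \<bullet> y \<le> 0" "z \<bullet> e > 0"
      using opt zero normalize_strategy[OF z] by (auto simp: optimal_pair_def)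
    then show ?thesis by (simp add: linear_cmul[OF assms(1)] divide_le_0_iff)
  qed
  ultimately show "x \<in> strategies K e \<and> y \<in> strategies K e \<and> L x \<in> K \<and> (\<forall>z\<in>K. L z \<bullet> y \<le> 0)"
    using opt by (auto simp: optimal_pair_def)
next
  assume *: "x \<in> strategies K e \<and> y \<in> strategies K e \<and> L x \<in> K \<and> (\<forall>z\<in>K. L z \<bullet> y \<le> 0)"
  then have K: "x \<in> K" "y \<in> K" "\<And>z. z \<in> strategies K e \<Longrightarrow> z \<in> K"
    using strategies_subset by blast+
  then have zero: "L x \<bullet> y = 0"
    using inner_nonneg[of "L x" y] * by (simp add: order_antisym)
  show "optimal_pair K L e x y"
    unfolding optimal_pair_def zero using * K(3) inner_nonneg[of "L x"] by blast
qed

lemma linear_functional_zero_if_zero_at_interior: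
  assumes "linear f" "\<And>x. x \<in> K \<Longrightarrow> f x \<le> 0" "d \<in> interior K" "f d = (0::real)"
  shows "f x = 0"
proof -
  obtain \<epsilon> where \<epsilon>: "\<epsilon> > 0" "d + \<epsilon> *\<^sub>R x \<in> K" "d - \<epsilon> *\<^sub>R x \<in> K"
    using interior_absorbs[OF assms(3)] by blast
  then have "\<epsilon> * f x \<le> 0" "- (\<epsilon> * f x) \<le> 0"
    using assms(2)[OF \<epsilon>(2)] assms(2)[OF \<epsilon>(3)] assms(4)
    by (simp_all add: linear_add[OF assms(1)] linear_diff[OF assms(1)] linear_cmul[OF assms(1)])
  then show ?thesis using \<epsilon>(1) by (simp add: mult_le_0_iff zero_le_mult_iff)
qed

lemma payoff_against_optimal_eq_zero:
  assumes "linear L" "game_value K L e = 0" "optimal_pair K L e x y" "x \<in> interior K"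
  shows "L z \<bullet> y = 0"
proof (rule linear_functional_zero_if_zero_at_interior[where f = "\<lambda>z. L z \<bullet> y" and d = x])
  show "linear (\<lambda>z. L z \<bullet> y)"
    using assms(1) by (auto intro!: linearI simp: linear_add linear_cmul inner_add_left)
  show "L z \<bullet> y \<le> 0" if "z \<in> K" for z
    using assms that optimal_pair_zero_iff by blast
  show "L x \<bullet> y = 0" using assms game_value_eq by metis
qed (fact assms(4))


section \<open>Positive resolvents of Z-transformations\<close>

text \<open>If \<open>M x \<in> K\<close> but \<open>x \<notin> K\<close>, add to \<open>x\<close> the multiple of \<open>e\<close> that brings it to the boundary, and let
  \<open>y \<in> K\<close> be orthogonal to the resulting point. The Z-property makes the image of that point pair
  nonpositively with \<open>y\<close>. But this image is a point of \<open>K\<close> plus a positive multiple of the interior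
  point \<open>M e\<close>.\<close>

lemma Z_inverse_positive:
  assumes "Z_transformation K M" "M e \<in> interior K" "M x \<in> K"
  shows "x \<in> K"
proof (rule ccontr)
  assume "x \<notin> K"
  have lin: "linear M" using assms(1) by (simp add: Z_transformation_def)
  obtain y where y: "y \<in> strategies K e" "x - (x \<bullet> y) *\<^sub>R e \<in> K"
      "(x - (x \<bullet> y) *\<^sub>R e) \<bullet> y = 0"
    using minimizing_strategy by blast
  have yK: "y \<in> K" using y strategies_subset by blast
  have neg: "x \<bullet> y < 0"
  proof (rule ccontr)
    assume "\<not> x \<bullet> y < 0"
    then have "(x - (x \<bullet> y) *\<^sub>R e) + (x \<bullet> y) *\<^sub>R e \<in> K"
      using y unit_mem by (intro add_mem scale_mem) auto
    then show False using \<open>x \<notin> K\<close> by simp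
  qed
  have "M (x - (x \<bullet> y) *\<^sub>R e) \<bullet> y \<le> 0"
    using assms(1) y yK unfolding Z_transformation_def dual_eq by blast
  then have "M x \<bullet> y \<le> (x \<bullet> y) * (M e \<bullet> y)"
    by (simp add: linear_diff[OF lin] linear_cmul[OF lin] inner_diff_left)
  moreover have "M x \<bullet> y \<ge> 0" using assms(3) yK inner_nonneg by blast
  moreover have "M e \<bullet> y > 0"
    using interior_inner_pos[OF assms(2) yK] y strategies_nonzero by blast
  ultimately show False using mult_neg_pos[OF neg] by fastforce
qed

text \<open>A multiple of the identity does not affect the Z-property, because the latter concerns orthogonal pairs
  only; a large multiple makes the image of \<open>e\<close> interior. Injectivity of \<open>L + s I\<close> then comes from inverse
  positivity: the kernel lies in \<open>K \<inter> -K = {0}\<close>.\<close>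

lemma Z_resolvent:
  assumes "Z_transformation K L"
  obtains s T where "s > 0" "linear T" "\<And>x. L (T x) + s *\<^sub>R T x = x"
    "\<And>x. T (L x + s *\<^sub>R x) = x" "\<And>x. x \<in> K \<Longrightarrow> T x \<in> K"
proof -
  have lin: "linear L" using assms by (simp add: Z_transformation_def)
  obtain \<epsilon> where \<epsilon>: "\<epsilon> > 0" "e + \<epsilon> *\<^sub>R L e \<in> K"
    using interior_absorbs[OF unit_interior] by blast
  \<comment> \<open>The summand \<open>1 / \<epsilon>\<close> brings \<open>L e + s e\<close> into \<open>K\<close>; the extra \<open>1\<close> makes it interior.\<close>
  define s where "s = 1 / \<epsilon> + 1"
  have s: "s > 0" using \<epsilon> by (simp add: s_def add_pos_pos)
  define M where "M x = L x + s *\<^sub>R x" for x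
  have M_lin: "linear M"
    unfolding M_def by (intro linear_compose_add lin linear_scale_self)
  have "(1 / \<epsilon>) *\<^sub>R (e + \<epsilon> *\<^sub>R L e) \<in> K" using \<epsilon> by (intro scale_mem) auto
  then have "M e - 1 *\<^sub>R e \<in> K" using \<epsilon> by (simp add: M_def s_def algebra_simps)
  then have Me: "M e \<in> interior K" by (subst interior_iff) (blast intro: zero_less_one)
  have "Z_transformation K M"
    using assms M_lin by (auto simp: Z_transformation_def M_def inner_add_left)
  then have pos: "x \<in> K" if "M x \<in> K" for x
    using Z_inverse_positive Me that by blast
  have "inj M"
  proof (rule linear_injective_0[OF M_lin, THEN iffD2], intro allI impI)
    fix x assume "M x = 0"
    moreover then have "M (- x) = 0" using M_lin by (simp add: linear_neg)
    moreover have "0 \<in> K" using cone by (rule convex_cone_contains_0)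
    ultimately show "x = 0" using pos pointed by metis
  qed
  then obtain T where T: "linear T" "\<And>x. T (M x) = x" "\<And>x. M (T x) = x"
    using linear_injective_isomorphism[OF M_lin] by blast
  have T_pos: "T x \<in> K" if "x \<in> K" for x
    by (rule pos) (simp only: T(3) that)
  show thesis
    using s T(1) T(3)[unfolded M_def] T(2)[unfolded M_def] T_pos by (rule that)
qed


section \<open>Faces and invariant spans\<close>

lemma cone_face_eq_Int:
  assumes "cone_face F K"
  shows "F = K \<inter> cone_diff F"
proof
  have F: "F \<subseteq> K" "0 \<in> F"
    using assms convex_cone_contains_0 unfolding cone_face_def by blast+
  have "x = x - 0" for x :: 'a by simp
  then have "F \<subseteq> cone_diff F" using F(2) unfolding cone_diff_def by blast
  then show "F \<subseteq> K \<inter> cone_diff F" using F(1) by blast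
  show "K \<inter> cone_diff F \<subseteq> F"
  proof
    fix z assume "z \<in> K \<inter> cone_diff F"
    then obtain a b where z: "z \<in> K" "a \<in> F" "b \<in> F" "z = a - b"
      unfolding cone_diff_def by blast
    then have "a = z + b" by simp
    then show "z \<in> F" using assms z F(1) unfolding cone_face_def by blast
  qed
qed

lemma face_eq_cone_if_interior:
  assumes "cone_face F K" "x \<in> F" "x \<in> interior K"
  shows "F = K"
proof -
  have "z \<in> F" if z: "z \<in> K" for z
  proof -
    obtain \<epsilon> where \<epsilon>: "\<epsilon> > 0" "x - \<epsilon> *\<^sub>R z \<in> K" using interior_absorbs[OF assms(3)] by blast
    have "\<epsilon> *\<^sub>R z \<in> K" using \<epsilon> z scale_mem by simp
    moreover have "x = \<epsilon> *\<^sub>R z + (x - \<epsilon> *\<^sub>R z)" by simp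
    ultimately have "\<epsilon> *\<^sub>R z \<in> F" using assms \<epsilon> unfolding cone_face_def by blast
    then have "(1 / \<epsilon>) *\<^sub>R (\<epsilon> *\<^sub>R z) \<in> F"
      using assms(1) \<epsilon> unfolding cone_face_def by (meson convex_cone_scaleR less_imp_le zero_le_divide_1_iff)
    then show ?thesis using \<epsilon> by simp
  qed
  then show ?thesis using assms(1) by (auto simp: cone_face_def)
qed

end

lemma subspace_cone_diff:
  assumes "convex_cone F"
  shows "subspace (cone_diff F)"
proof (rule subspaceI)
  show "0 \<in> cone_diff F"
    using convex_cone_contains_0[OF assms] by (force simp: cone_diff_def)
next
  fix x y assume "x \<in> cone_diff F" "y \<in> cone_diff F"
  then obtain a b a' b' where "a \<in> F" "b \<in> F" "a' \<in> F" "b' \<in> F" "x = a - b" "y = a' - b'"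
    by (auto simp: cone_diff_def)
  moreover from this have "x + y = (a + a') - (b + b')" by simp
  ultimately show "x + y \<in> cone_diff F"
    unfolding cone_diff_def using convex_cone_add[OF assms] by blast
next
  fix c :: real and x assume "x \<in> cone_diff F"
  then obtain a b where ab: "a \<in> F" "b \<in> F" "x = a - b"
    by (auto simp: cone_diff_def)
  show "c *\<^sub>R x \<in> cone_diff F"
  proof (cases "c \<ge> 0")
    case True
    then have "c *\<^sub>R a \<in> F" "c *\<^sub>R b \<in> F" "c *\<^sub>R x = c *\<^sub>R a - c *\<^sub>R b"
      using ab convex_cone_scaleR[OF assms] by (auto simp: scaleR_diff_right)
    then show ?thesis unfolding cone_diff_def by blast
  next
    case False
    then have "(-c) *\<^sub>R b \<in> F" "(-c) *\<^sub>R a \<in> F" "c *\<^sub>R x = (-c) *\<^sub>R b - (-c) *\<^sub>R a"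
      using ab convex_cone_scaleR[OF assms, of "-c"] by (auto simp: scaleR_diff_right)
    then show ?thesis unfolding cone_diff_def by blast
  qed
qed

lemma cone_diff_image_subset:
  assumes "linear T" "T ` F \<subseteq> F"
  shows "T ` cone_diff F \<subseteq> cone_diff F"
  using assms by (fastforce simp: cone_diff_def linear_diff)

text \<open>In finite dimension an injective map that sends \<open>W\<close> into \<open>W\<close> sends it onto \<open>W\<close>. This transfers
  invariance in either direction between \<open>L + s I\<close> and its inverse.\<close>

lemma linear_left_inverse_preserves_subspace:
  fixes M T :: "'a::euclidean_space \<Rightarrow> 'a"
  assumes "linear M" "\<And>x. T (M x) = x" "subspace W" "M ` W \<subseteq> W"
  shows "T ` W \<subseteq> W"
proof -
  have "inj M" using assms(2) by (metis injI)
  then have "dim (M ` W) = dim W"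
    using assms(1) by (intro dim_image_eq) (auto intro: inj_on_subset)
  then have "M ` W = W"
    using assms by (intro subspace_dim_equal linear_subspace_image) auto
  then show ?thesis using assms(2) by (metis image_subsetI imageE)
qed

context self_dual_cone_unit
begin

lemma irreducible_resolvent_invariant_face:
  assumes irr: "space_irreducible K L"
    and T: "linear T" "\<And>x. L (T x) + s *\<^sub>R T x = x"
    and F: "cone_face F K" "T ` F \<subseteq> F"
  shows "F = {0} \<or> F = K"
proof -
  let ?W = "cone_diff F"
  have "convex_cone F" using F(1) by (simp add: cone_face_def)
  then have W: "subspace ?W" by (rule subspace_cone_diff)
  have shifted: "(\<lambda>x. L x + s *\<^sub>R x) ` ?W \<subseteq> ?W"
    by (rule linear_left_inverse_preserves_subspace
        [where T = "\<lambda>x. L x + s *\<^sub>R x", OF T W cone_diff_image_subset[OF T(1) F(2)]])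
  have "L ` ?W \<subseteq> ?W"
  proof (rule image_subsetI)
    fix x assume x: "x \<in> ?W"
    then have "(L x + s *\<^sub>R x) - s *\<^sub>R x \<in> ?W"
      using shifted by (intro subspace_diff[OF W] subspace_scale[OF W]) auto
    then show "L x \<in> ?W" by simp
  qed
  then show ?thesis using irr F(1) unfolding space_irreducible_def by blast
qed

text \<open>A Perron-Frobenius argument inside the face: the resolvent is a positive map on \<open>F\<close>, and a fixed point of
  its normalization is an eigenvector of the resolvent, hence of \<open>L\<close>.\<close>

lemma invariant_face_eigenvector:
  assumes Z: "Z_transformation K L"
    and F: "cone_face F K" "L ` cone_diff F \<subseteq> cone_diff F" "F \<noteq> {0}"
  obtains x \<mu> where "x \<in> F" "x \<in> strategies K e" "L x = \<mu> *\<^sub>R x"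
proof -
  let ?W = "cone_diff F" and ?S = "F \<inter> strategies K e"
  have lin: "linear L" using Z by (simp add: Z_transformation_def)
  have cF: "convex_cone F" using F by (simp add: cone_face_def)
  have W: "subspace ?W" using cF by (rule subspace_cone_diff)
  obtain s T where T: "s > 0" "linear T" "\<And>x. L (T x) + s *\<^sub>R T x = x"
      "\<And>x. T (L x + s *\<^sub>R x) = x" "\<And>x. x \<in> K \<Longrightarrow> T x \<in> K"
    using Z_resolvent[OF Z] by blast
  have "T ` ?W \<subseteq> ?W"
  proof (rule linear_left_inverse_preserves_subspace[where M = "\<lambda>x. L x + s *\<^sub>R x", OF _ T(4) W])
    show "linear (\<lambda>x. L x + s *\<^sub>R x)"
      by (intro linear_compose_add lin linear_scale_self)
    show "(\<lambda>x. L x + s *\<^sub>R x) ` ?W \<subseteq> ?W"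
      using F(2) W by (auto intro!: subspace_add subspace_scale)
  qed
  then have TF: "T x \<in> F" if "x \<in> F" for x
    using that T(5) cone_face_eq_Int[OF F(1)] by blast
  have T_nz: "T x \<noteq> 0" if "x \<noteq> 0" for x
    using T(3)[of x] that lin by (auto simp: linear_0)
  have FK: "F \<subseteq> K" using F by (simp add: cone_face_def)
  obtain f where f: "f \<in> F" "f \<noteq> 0"
    using F(3) convex_cone_contains_0[OF cF] by blast
  let ?g = "\<lambda>x. (1 / (T x \<bullet> e)) *\<^sub>R T x"
  have norm_in: "(1 / (x \<bullet> e)) *\<^sub>R x \<in> ?S" if "x \<in> F" "x \<noteq> 0" for x
    using normalize_strategy[of x] that FK convex_cone_scaleR[OF cF] by auto
  have "?S \<noteq> {}" using norm_in[OF f] by blast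
  moreover have "?S = ?W \<inter> strategies K e"
    using cone_face_eq_Int[OF F(1)] strategies_subset by blast
  then have "compact ?S"
    using W strategies_compact by (simp add: closed_Int_compact closed_subspace)
  moreover have "convex ?S"
    using cF strategies_convex by (simp add: convex_Int convex_cone_def)
  moreover have "continuous_on ?S ?g"
  proof -
    have "continuous_on ?S T"
      using T(2) by (simp add: linear_continuous_on linear_conv_bounded_linear)
    moreover have "T x \<bullet> e \<noteq> 0" if "x \<in> ?S" for x
      using that normalize_strategy(1)[of "T x"] TF FK T_nz strategies_nonzero by fastforce
    ultimately show ?thesis by (intro continuous_intros) auto
  qed
  moreover have "?g \<in> ?S \<rightarrow> ?S"
  proof
    fix x assume "x \<in> ?S"
    then show "?g x \<in> ?S" using norm_in TF T_nz strategies_nonzero by blast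
  qed
  ultimately obtain x where x: "x \<in> ?S" "?g x = x"
    using brouwer[of ?S ?g] by blast
  define \<rho> where "\<rho> = T x \<bullet> e"
  have \<rho>: "\<rho> > 0"
    using x normalize_strategy(1)[of "T x"] TF FK T_nz strategies_nonzero by (auto simp: \<rho>_def)
  have Tx: "T x = \<rho> *\<^sub>R x"
    using x(2) \<rho> by (metis \<rho>_def divide_self_if less_irrefl mult.commute scaleR_one scaleR_scaleR times_divide_eq_left mult_1)
  have "\<rho> *\<^sub>R L x + (s * \<rho>) *\<^sub>R x = x"
    using T(3)[of x] by (simp add: Tx linear_cmul[OF lin])
  then have "(1 / \<rho>) *\<^sub>R (\<rho> *\<^sub>R L x) = (1 / \<rho>) *\<^sub>R (x - (s * \<rho>) *\<^sub>R x)"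
    by (metis add_diff_cancel_right')
  then have "L x = (1 / \<rho> - s) *\<^sub>R x"
    using \<rho> by (simp add: scaleR_diff_right scaleR_diff_left)
  then show thesis using that x by blast
qed


section \<open>Completely mixed games and irreducibility\<close>

text \<open>An eigenvector of \<open>L\<close> in a nonzero invariant face other than \<open>K\<close> would have eigenvalue \<open>0\<close>, because it pairs positively
  with \<open>yb\<close>, which annihilates the range of \<open>L\<close>. It would then be an optimal strategy on the
  boundary.\<close>

lemma completely_mixed_imp_irreducible:
  assumes Z: "Z_transformation K L" and val: "game_value K L e = 0"
    and mixed: "completely_mixed K L e"
  shows "space_irreducible K L"
  unfolding space_irreducible_def
proof (intro allI impI, elim conjE)
  fix F assume F: "cone_face F K" "L ` cone_diff F \<subseteq> cone_diff F"
  have lin: "linear L" using Z by (simp add: Z_transformation_def)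
  obtain xb yb where opt: "optimal_pair K L e xb yb"
    using optimal_pair_exists[OF lin] by blast
  then have int: "xb \<in> interior K" "yb \<in> interior K"
    using mixed unfolding completely_mixed_def by blast+
  have ann: "L z \<bullet> yb = 0" for z
    using payoff_against_optimal_eq_zero[OF lin val opt int(1)] .
  have "F = K" if nonzero: "F \<noteq> {0}"
  proof -
    obtain x \<mu> where x: "x \<in> F" "x \<in> strategies K e" "L x = \<mu> *\<^sub>R x"
      using invariant_face_eigenvector[OF Z F nonzero] by blast
    have "yb \<bullet> x > 0"
      using interior_inner_pos[OF int(2)] x(2) strategies_subset strategies_nonzero by blast
    then have "\<mu> = 0" using ann[of x] x(3) by (simp add: inner_commute)
    then have "L x \<in> K" using x(3) cone by (simp add: convex_cone_contains_0)
    then have "optimal_pair K L e x yb"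
      using opt ann x(2) by (simp add: optimal_pair_zero_iff[OF lin val])
    then have "x \<in> interior K" using mixed unfolding completely_mixed_def by blast
    then show "F = K" by (rule face_eq_cone_if_interior[OF F(1) x(1)])
  qed
  then show "F = {0} \<or> F = K" by blast
qed

text \<open>The order ideal generated by \<open>x\<close>, which is the smallest face that contains \<open>x\<close>.\<close>

lemma cone_face_generated:
  assumes "x \<in> K"
  shows "cone_face {z \<in> K. \<exists>t\<ge>0. t *\<^sub>R x - z \<in> K} K" (is "cone_face ?F K")
proof -
  have "convex_cone ?F"
    unfolding convex_cone_iff
  proof (intro conjI ballI allI impI)
    show "0 \<in> ?F"
      using cone convex_cone_contains_0 by (auto intro!: exI[of _ 0])
  next
    fix a b assume "a \<in> ?F" "b \<in> ?F"
    then obtain t u where *: "a \<in> K" "b \<in> K" "t \<ge> 0" "u \<ge> 0" "t *\<^sub>R x - a \<in> K" "u *\<^sub>R x - b \<in> K"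
      by blast
    have "(t + u) *\<^sub>R x - (a + b) \<in> K"
      using add_mem[OF *(5,6)] by (simp add: algebra_simps)
    moreover have "t + u \<ge> 0" using * by simp
    ultimately show "a + b \<in> ?F" using * add_mem by blast
  next
    fix a and c :: real assume "a \<in> ?F" and c: "0 \<le> c"
    then obtain t where *: "a \<in> K" "t \<ge> 0" "t *\<^sub>R x - a \<in> K" by blast
    have "(c * t) *\<^sub>R x - c *\<^sub>R a \<in> K"
      using scale_mem[OF *(3) c] by (simp add: algebra_simps)
    moreover have "c * t \<ge> 0" using * c by simp
    ultimately show "c *\<^sub>R a \<in> ?F" using * c scale_mem by blast
  qed
  moreover have "b \<in> ?F" if bc: "b \<in> K" "c \<in> K" "b + c \<in> ?F" for b c
  proof -
    obtain t where t: "t \<ge> 0" "t *\<^sub>R x - (b + c) \<in> K" using bc by blast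
    have "t *\<^sub>R x - b \<in> K" using add_mem[OF t(2) bc(2)] by simp
    then show ?thesis using t bc by blast
  qed
  ultimately show ?thesis
    unfolding cone_face_def by (metis (no_types, lifting) add.commute mem_Collect_eq subsetI)
qed

lemma cone_face_orthogonal:
  assumes "y \<in> K"
  shows "cone_face {z \<in> K. z \<bullet> y = 0} K"
proof -
  have "convex_cone {z \<in> K. z \<bullet> y = 0}"
    using cone by (auto simp: convex_cone_iff inner_add_left)
  moreover have "b \<bullet> y = 0 \<and> c \<bullet> y = 0" if "b \<in> K" "c \<in> K" "(b + c) \<bullet> y = 0" for b c
    using that inner_nonneg[OF _ assms, of b] inner_nonneg[OF _ assms, of c]
    by (simp add: inner_add_left)
  ultimately show ?thesis unfolding cone_face_def by auto
qed

text \<open>Each of the two optimal strategies yields a face that the resolvent preserves: the face generated by \<open>x\<close>,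
  and the face orthogonal to \<open>y\<close>. The order matters, since invariance of the second face uses that \<open>y\<close>
  annihilates the range of \<open>L\<close>, which is known only once \<open>x\<close> is interior.\<close>

lemma irreducible_imp_completely_mixed:
  assumes Z: "Z_transformation K L" and val: "game_value K L e = 0"
    and irr: "space_irreducible K L"
  shows "completely_mixed K L e"
  unfolding completely_mixed_def
proof (intro allI impI)
  fix x y assume opt: "optimal_pair K L e x y"
  have lin: "linear L" using Z by (simp add: Z_transformation_def)
  have xy: "x \<in> strategies K e" "y \<in> strategies K e" and Lx: "L x \<in> K"
    using opt optimal_pair_zero_iff[OF lin val] by blast+
  then have xK: "x \<in> K" "x \<noteq> 0" and yK: "y \<in> K" "y \<noteq> 0"
    using strategies_subset strategies_nonzero by blast+
  obtain s T where T: "s > 0" "linear T" "\<And>x. L (T x) + s *\<^sub>R T x = x"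
      "\<And>x. T (L x + s *\<^sub>R x) = x" "\<And>x. x \<in> K \<Longrightarrow> T x \<in> K"
    using Z_resolvent[OF Z] by blast

  let ?F = "{z \<in> K. \<exists>t\<ge>0. t *\<^sub>R x - z \<in> K}"
  have "T z \<in> ?F" if z: "z \<in> ?F" for z
  proof -
    obtain t where t: "t \<ge> 0" "t *\<^sub>R x - z \<in> K" using z by blast
    \<comment> \<open>Applying \<open>T\<close> to this element of \<open>K\<close> shows that \<open>T z\<close> is dominated by \<open>(t / s) x\<close>.\<close>
    have "(t / s) *\<^sub>R L x + (t *\<^sub>R x - z) \<in> K"
      using t T(1) Lx by (intro add_mem scale_mem) auto
    moreover have "T ((t / s) *\<^sub>R L x + (t *\<^sub>R x - z)) = (t / s) *\<^sub>R x - T z"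
    proof -
      have "(t / s) *\<^sub>R L x + (t *\<^sub>R x - z) = (t / s) *\<^sub>R (L x + s *\<^sub>R x) - z"
        using T(1) by (simp add: scaleR_add_right)
      then show ?thesis by (simp only: linear_diff[OF T(2)] linear_cmul[OF T(2)] T(4))
    qed
    ultimately have "(t / s) *\<^sub>R x - T z \<in> K" using T(5) by metis
    moreover have "t / s \<ge> 0" using t T(1) by simp
    ultimately show ?thesis using z T(5) by blast
  qed
  then have "?F = {0} \<or> ?F = K"
    by (intro irreducible_resolvent_invariant_face[OF irr T(2,3) cone_face_generated[OF xK(1)]]) blast
  moreover have "x \<in> ?F"
    using xK(1) cone convex_cone_contains_0 by (auto intro!: exI[of _ 1])
  ultimately have "e \<in> ?F" using xK(2) unit_mem by blast
  then obtain t where t: "t \<ge> 0" "t *\<^sub>R x - e \<in> K" by blast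
  have "t \<noteq> 0"
    using t pointed[OF unit_mem] xy(1) by (auto simp: strategies_def)
  then have "t > 0" using t by simp
  moreover then have "x - (1 / t) *\<^sub>R e \<in> K"
    using scale_mem[OF t(2), of "1 / t"] by (simp add: scaleR_diff_right)
  ultimately have x_int: "x \<in> interior K"
    by (subst interior_iff) (meson zero_less_divide_1_iff)

  let ?G = "{z \<in> K. z \<bullet> y = 0}"
  have ann: "L z \<bullet> y = 0" for z
    using payoff_against_optimal_eq_zero[OF lin val opt x_int] .
  have "T z \<in> ?G" if "z \<in> ?G" for z
  proof -
    have "s * (T z \<bullet> y) = z \<bullet> y"
      using arg_cong[OF T(3)[of z], of "\<lambda>w. w \<bullet> y"] ann by (simp add: inner_add_left)
    then show ?thesis using that T(1,5) by auto
  qed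
  then have "?G = {0} \<or> ?G = K"
    by (intro irreducible_resolvent_invariant_face[OF irr T(2,3) cone_face_orthogonal[OF yK(1)]]) blast
  moreover have "y \<notin> ?G" using yK by simp
  ultimately have G: "?G = {0}" using yK by blast
  have "y \<in> interior K"
  proof (rule interior_if_inner_pos)
    fix z assume "z \<in> strategies K e"
    then have "z \<in> K" "z \<noteq> 0" using strategies_subset strategies_nonzero by blast+
    then have "z \<bullet> y \<noteq> 0" "z \<bullet> y \<ge> 0" using G inner_nonneg yK by blast+
    then show "y \<bullet> z > 0" by (simp add: inner_commute)
  qed
  then show "x \<in> interior K \<and> y \<in> interior K" using x_int by simp
qed

end

theorem theorem3p3:
  fixes K :: "'a::euclidean_space set"
    and e :: 'a
    and L :: "'a \<Rightarrow> 'a"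
  assumes "self_dual_cone K"
    and "e \<in> interior K"
    and "Z_transformation K L"
    and "game_value K L e = 0"
  shows "completely_mixed K L e \<longleftrightarrow> space_irreducible K L"
proof -
  interpret self_dual_cone_unit K e
    using assms by unfold_locales
  show ?thesis
    using assms completely_mixed_imp_irreducible irreducible_imp_completely_mixed by blast
qed

end
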